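(* Let $q\in\mathbb{N}$ and $\mathbf{c}=(c_1,\dots,c_q)\in\mathbb{N}^q$. For $\mathbf{n}=(n_1,\dots,n_q)\in\mathbb{N}^q$ let $I_{\mathbf{n}}$ be the kernel of the $\mathbb{K}$-algebra homomorphism $$\Phi_{\mathbf{n}}\colon R_{\mathbf{n}}=\mathbb{K}[x_{\mathbf{i},\mathbf{k}}\mid(\mathbf{i},\mathbf{k})\in[\mathbf{c}]\times[\mathbf{n}]]\to\mathbb{K}[y_{j,i,k}\mid j\in[q],\,i\in[c_j],\,k\in[n_j]],\qquad x_{\mathbf{i},\mathbf{k}}\mapsto\prod_{j=1}^q y_{j,i_j,k_j},$$ and let $\mathscr{I}=(I_{\mathbf{n}})_{\mathbf{n}\in\mathbb{N}^q}$. For $j\in[q]$ let $\omega_j\in\mathbb{C}$ be a primitive $c_j$-th root of unity. Then the equivariant Hilbert series of $\mathscr{I}$ is $$\mathrm{equivH}_{\mathscr{I}}(s_1,\dots,s_q,t)=\frac{1}{c_1\cdots c_q}\sum_{m_1\in[c_1],\dots,m_q\in[c_q]}\frac{\omega_1^{m_1}s_1^{1/c_1}\cdots\omega_q^{m_q}s_q^{1/c_q}}{(1-\omega_1^{m_1}s_1^{1/c_1})\cdots(1-\omega_q^{m_q}s_q^{1/c_q})-t}.$$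
   Context: $\mathbb{N}$ denotes the positive integers, $\mathbb{K}$ is a field, $[n]=\{1,\dots,n\}$, $[\mathbf{c}]=[c_1]\times\cdots\times[c_q]$, $[\mathbf{n}]=[n_1]\times\cdots\times[n_q]$, $\mathbf{i}=(i_1,\dots,i_q)$, $\mathbf{k}=(k_1,\dots,k_q)$. The family $\mathscr{I}$ is the filtration of toric ideals of the hierarchical models with $q$ pairwise disjoint two-element facets $F_1,\dots,F_q$, each meeting the set $T$ of parameters with varying number of states in exactly one vertex; in $F_j$ the parameter outside $T$ has $c_j$ states and the parameter in $T$ has $n_j$ states. The equivariant Hilbert series is the formal power series $$\mathrm{equivH}_{\mathscr{I}}(s_1,\dots,s_q,t)=\sum_{\mathbf{n}\in\mathbb{N}^q}\ \sum_{d\ge0}\dim_{\mathbb{K}}[R_{\mathbf{n}}/I_{\mathbf{n}}]_d\; s_1^{n_1}\cdots s_q^{n_q}\,t^d,$$ where all variables of $R_{\mathbf{n}}$ have degree one. The right-hand side of the claimed formula is understood as a formal power series in $s_1^{1/c_1},\dots,s_q^{1/c_q},t$ with complex coefficients, where $s_j^{1/c_j}$ is a formal $c_j$-th root of $s_j$ (each denominator has constant term $1$, hence is invertible). *)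

theory Defs
  imports
    Complex_Main
    "HOL-Library.FuncSet"
    "HOL-Library.Poly_Mapping"
    "HOL-Algebra.QuotRing"
    "HOL-Algebra.Embedded_Algebras"
begin

section \<open>Multivariate polynomials\<close>

text \<open>
  A monomial is an exponent vector with finite support, a polynomial is a finitely supported
  family of coefficients; the ring structure (convolution) is that of \<^theory>\<open>HOL-Library.Poly_Mapping\<close>.
\<close>

type_synonym 'v monomial = "'v \<Rightarrow>\<^sub>0 nat"
type_synonym ('v, 'k) mpoly = "'v monomial \<Rightarrow>\<^sub>0 'k"

definition mdeg :: "'v monomial \<Rightarrow> nat" where
  "mdeg m = (\<Sum>v\<in>Poly_Mapping.keys m. Poly_Mapping.lookup m v)"

definition Const :: "'k::comm_ring_1 \<Rightarrow> ('v, 'k) mpoly" where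
  "Const a = Poly_Mapping.single 0 a"

definition Var :: "'v \<Rightarrow> ('v, 'k::comm_ring_1) mpoly" where
  "Var v = Poly_Mapping.single (Poly_Mapping.single v 1) 1"

definition poly_ring :: "'v set \<Rightarrow> ('v, 'k::comm_ring_1) mpoly ring" where
  "poly_ring V =
    \<lparr> carrier = {p. \<forall>m\<in>Poly_Mapping.keys p. Poly_Mapping.keys m \<subseteq> V},
      mult = (*), one = 1, zero = 0, add = (+) \<rparr>"

definition poly_subst :: "('v \<Rightarrow> ('w, 'k) mpoly) \<Rightarrow> ('v, 'k::comm_ring_1) mpoly \<Rightarrow> ('w, 'k) mpoly" where
  "poly_subst \<sigma> p =
    (\<Sum>m\<in>Poly_Mapping.keys p. Const (Poly_Mapping.lookup p m) *
       (\<Prod>v\<in>Poly_Mapping.keys m. \<sigma> v ^ Poly_Mapping.lookup m v))"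

definition homogeneous :: "nat \<Rightarrow> ('v, 'k::comm_ring_1) mpoly \<Rightarrow> bool" where
  "homogeneous d p \<longleftrightarrow> (\<forall>m\<in>Poly_Mapping.keys p. mdeg m = d)"

text \<open>
  The dimension of the degree \<open>d\<close> part of the quotient of \<open>poly_ring V\<close> by \<open>I\<close>: that part is the
  set of residue classes of the homogeneous polynomials of degree \<open>d\<close>, and the ground field sits
  in the quotient ring as the residue classes of the constants.
\<close>

definition hilbert_fun :: "'v set \<Rightarrow> ('v, 'k::field) mpoly set \<Rightarrow> nat \<Rightarrow> nat" where
  "hilbert_fun V I d =
    ring.dim (poly_ring V Quot I)
      ((\<lambda>a. I +>\<^bsub>poly_ring V\<^esub> Const a) ` UNIV)
      ((\<lambda>p. I +>\<^bsub>poly_ring V\<^esub> p) ` {p \<in> carrier (poly_ring V). homogeneous d p})"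


section \<open>The ideals\<close>

text \<open>
  The indices \<open>\<^bold>i\<close> and \<open>\<^bold>k\<close> are (extensional) functions on \<open>{1..q}\<close>; the variable
  \<open>y\<^bsub>j,i,k\<^esub>\<close> is the triple \<open>(j, i, k)\<close>.
\<close>

type_synonym xvar = "(nat \<Rightarrow> nat) \<times> (nat \<Rightarrow> nat)"
type_synonym yvar = "nat \<times> nat \<times> nat"

definition box :: "nat \<Rightarrow> (nat \<Rightarrow> nat) \<Rightarrow> (nat \<Rightarrow> nat) set" where
  "box q c = (\<Pi>\<^sub>E j\<in>{1..q}. {1..c j})"

definition xvars :: "nat \<Rightarrow> (nat \<Rightarrow> nat) \<Rightarrow> (nat \<Rightarrow> nat) \<Rightarrow> xvar set" where
  "xvars q c n = box q c \<times> box q n"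

definition yvars :: "nat \<Rightarrow> (nat \<Rightarrow> nat) \<Rightarrow> (nat \<Rightarrow> nat) \<Rightarrow> yvar set" where
  "yvars q c n = (SIGMA j:{1..q}. {1..c j} \<times> {1..n j})"

definition Phi :: "nat \<Rightarrow> (xvar, 'k::field) mpoly \<Rightarrow> (yvar, 'k) mpoly" where
  "Phi q = poly_subst (\<lambda>(i, k). \<Prod>j=1..q. Var (j, i j, k j))"

definition toric_ideal :: "nat \<Rightarrow> (nat \<Rightarrow> nat) \<Rightarrow> (nat \<Rightarrow> nat) \<Rightarrow> (xvar, 'k::field) mpoly set" where
  "toric_ideal q c n = a_kernel (poly_ring (xvars q c n)) (poly_ring (yvars q c n)) (Phi q)"


section \<open>Multivariate formal power series\<close>

typedef ('v, 'a) mps = "UNIV :: ('v monomial \<Rightarrow> 'a) set"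
  morphisms mps_nth Abs_mps ..

lemma mps_nth_Abs [simp]: "mps_nth (Abs_mps f) = f"
  by (simp add: Abs_mps_inverse)

lemma mps_eqI: "(\<And>m. mps_nth f m = mps_nth g m) \<Longrightarrow> f = g"
  by (metis ext mps_nth_inject)

lemma finite_splits: "finite {(a, b). a + b = (m :: 'v monomial)}"
proof -
  let ?l = "\<lambda>a :: 'v monomial. restrict (Poly_Mapping.lookup a) (Poly_Mapping.keys m)"
  have le: "Poly_Mapping.lookup a v \<le> Poly_Mapping.lookup m v" if "a + b = m" for a b v
    using that by (auto simp: lookup_add)
  have fin: "finite (\<Pi>\<^sub>E v\<in>Poly_Mapping.keys m. {..Poly_Mapping.lookup m v})"
    by (intro finite_PiE) auto
  have "?l ` {a. \<exists>b. a + b = m} \<subseteq> (\<Pi>\<^sub>E v\<in>Poly_Mapping.keys m. {..Poly_Mapping.lookup m v})"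
    using le by auto
  then have "finite (?l ` {a. \<exists>b. a + b = m})"
    using fin finite_subset by blast
  moreover have "inj_on ?l {a. \<exists>b. a + b = m}"
  proof (rule inj_onI)
    fix a a' assume "a \<in> {a. \<exists>b. a + b = m}" "a' \<in> {a. \<exists>b. a + b = m}" and eq: "?l a = ?l a'"
    then obtain b b' where ab: "a + b = m" "a' + b' = m" by blast
    show "a = a'"
    proof (rule poly_mapping_eqI)
      fix v
      show "Poly_Mapping.lookup a v = Poly_Mapping.lookup a' v"
      proof (cases "v \<in> Poly_Mapping.keys m")
        case True
        then show ?thesis using fun_cong[OF eq, of v] by simp
      next
        case False
        then have "Poly_Mapping.lookup m v = 0" by (simp add: in_keys_iff)
        then show ?thesis using le[OF ab(1), of v] le[OF ab(2), of v] by simp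
      qed
    qed
  qed
  ultimately have A: "finite {a. \<exists>b. a + b = m}"
    using finite_imageD by blast
  have "{(a, b). a + b = m} \<subseteq> (\<lambda>a. (a, m - a)) ` {a. \<exists>b. a + b = m}"
    by (auto simp: image_iff)
  then show ?thesis using A finite_subset by blast
qed

lemma finite_splits': "finite {p. fst p + snd p = (m :: 'v monomial)}"
  using finite_splits[of m] by (simp add: case_prod_unfold)

instantiation mps :: (type, comm_ring_1) comm_ring_1
begin

definition "0 = Abs_mps (\<lambda>_. 0)"
definition "1 = Abs_mps (\<lambda>m. if m = 0 then 1 else 0)"
definition "f + g = Abs_mps (\<lambda>m. mps_nth f m + mps_nth g m)"
definition "f - g = Abs_mps (\<lambda>m. mps_nth f m - mps_nth g m)"
definition "- f = Abs_mps (\<lambda>m. - mps_nth f m)"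
definition "f * g = Abs_mps (\<lambda>m. \<Sum>(a, b) | a + b = m. mps_nth f a * mps_nth g b)"

instance
proof
  fix f g h :: "('a, 'b) mps"
  show "f * g * h = f * (g * h)"
  proof (rule mps_eqI)
    fix m
    have "mps_nth (f * g * h) m =
        (\<Sum>(a, b) | a + b = m. \<Sum>(x, y) | x + y = a. mps_nth f x * mps_nth g y * mps_nth h b)"
      by (simp add: times_mps_def sum_distrib_right case_prod_unfold)
    also have "\<dots> = (\<Sum>((a, b), x, y) \<in> (SIGMA p:{(a, b). a + b = m}. {(x, y). x + y = fst p}).
        mps_nth f x * mps_nth g y * mps_nth h b)"
      by (subst sum.Sigma[symmetric]) (auto simp: finite_splits' case_prod_unfold)
    also have "\<dots> = (\<Sum>((x, a), y, b) \<in> (SIGMA p:{(x, a). x + a = m}. {(y, b). y + b = snd p}).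
        mps_nth f x * (mps_nth g y * mps_nth h b))"
      by (rule sum.reindex_bij_witness[where i = "\<lambda>((x, a), y, b). ((x + y, b), x, y)"
            and j = "\<lambda>((a, b), x, y). ((x, y + b), y, b)"]) (auto simp: ac_simps)
    also have "\<dots> = (\<Sum>(x, a) | x + a = m. \<Sum>(y, b) | y + b = a.
        mps_nth f x * (mps_nth g y * mps_nth h b))"
      by (subst sum.Sigma[symmetric]) (auto simp: finite_splits' case_prod_unfold)
    also have "\<dots> = mps_nth (f * (g * h)) m"
      by (simp add: times_mps_def sum_distrib_left case_prod_unfold)
    finally show "mps_nth (f * g * h) m = mps_nth (f * (g * h)) m" .
  qed
  show "f * g = g * f"
  proof (rule mps_eqI)
    fix m
    show "mps_nth (f * g) m = mps_nth (g * f) m"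
      unfolding times_mps_def mps_nth_Abs
      by (rule sum.reindex_bij_witness[where i = "\<lambda>(a, b). (b, a)" and j = "\<lambda>(a, b). (b, a)"])
         (auto simp: ac_simps)
  qed
  show "1 * f = f"
  proof (rule mps_eqI)
    fix m
    have "mps_nth (1 * f) m = (\<Sum>p\<in>{(a, b). a + b = m}. if p = (0, m) then mps_nth f m else 0)"
      unfolding times_mps_def mps_nth_Abs
      by (rule sum.cong) (auto simp: one_mps_def split: if_splits)
    also have "\<dots> = mps_nth f m"
      by (simp add: finite_splits)
    finally show "mps_nth (1 * f) m = mps_nth f m" .
  qed
  show "(f + g) * h = f * h + g * h"
    by (rule mps_eqI)
       (simp add: times_mps_def plus_mps_def case_prod_unfold distrib_right sum.distrib)
  show "(0::('a, 'b) mps) \<noteq> 1"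
  proof
    assume "(0::('a, 'b) mps) = 1"
    then have "mps_nth (0::('a, 'b) mps) 0 = mps_nth 1 0" by simp
    then show False by (simp add: zero_mps_def one_mps_def)
  qed
qed (auto intro!: mps_eqI simp: plus_mps_def zero_mps_def minus_mps_def uminus_mps_def ac_simps)

end

instantiation mps :: (type, field) inverse
begin

definition inverse_mps :: "('a, 'b) mps \<Rightarrow> ('a, 'b) mps" where
  "inverse f = (if mps_nth f 0 = 0 then 0 else THE g. f * g = 1)"
definition divide_mps_def: "f div (g :: ('a, 'b) mps) = f * inverse g"

instance ..

end

definition mps_const :: "'a::comm_ring_1 \<Rightarrow> ('v, 'a) mps" where
  "mps_const a = Abs_mps (\<lambda>m. if m = 0 then a else 0)"

definition mps_var :: "'v \<Rightarrow> ('v, 'a::comm_ring_1) mps" where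
  "mps_var v = Abs_mps (\<lambda>m. if m = Poly_Mapping.single v 1 then 1 else 0)"

lemma mdeg_eq_sum: "finite A \<Longrightarrow> Poly_Mapping.keys m \<subseteq> A \<Longrightarrow> mdeg m = (\<Sum>v\<in>A. Poly_Mapping.lookup m v)"
  unfolding mdeg_def by (rule sum.mono_neutral_left) (auto simp: in_keys_iff)

lemma mdeg_add: "mdeg (a + b) = mdeg a + mdeg b"
proof -
  let ?A = "Poly_Mapping.keys a \<union> Poly_Mapping.keys b"
  have "Poly_Mapping.keys (a + b) \<subseteq> ?A" by (rule Poly_Mapping.keys_add)
  then show ?thesis
    by (simp add: mdeg_eq_sum[of ?A] lookup_add sum.distrib)
qed

lemma mdeg_eq_0_iff: "mdeg m = 0 \<longleftrightarrow> m = 0"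
  unfolding mdeg_def by (auto simp: in_keys_iff intro: poly_mapping_eqI)

lemma mps_nth_sum: "mps_nth (\<Sum>i\<in>A. f i) m = (\<Sum>i\<in>A. mps_nth (f i) m)"
  by (induction A rule: infinite_finite_induct) (auto simp: zero_mps_def plus_mps_def)

lemma mps_nth_power_low:
  assumes "mps_nth u 0 = 0" "mdeg m < k"
  shows "mps_nth (u ^ k) m = 0"
  using assms(2)
proof (induction k arbitrary: m)
  case (Suc k)
  have "mps_nth u a * mps_nth (u ^ k) b = 0" if "a + b = m" for a b
  proof (cases "a = 0")
    case False
    then have "mdeg a > 0" using mdeg_eq_0_iff by auto
    then show ?thesis using Suc mdeg_add[of a b] that by auto
  qed (simp add: assms(1))
  then show ?case by (auto simp: times_mps_def intro!: sum.neutral)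
qed simp

lemma mps_const_mult: "mps_nth (mps_const c * f) m = c * mps_nth f m"
proof -
  have "mps_nth (mps_const c * f) m =
      (\<Sum>p\<in>{(a, b). a + b = m}. if p = (0, m) then c * mps_nth f m else 0)"
    unfolding times_mps_def mps_nth_Abs
    by (rule sum.cong) (auto simp: mps_const_def split: if_splits)
  then show ?thesis by (simp add: finite_splits)
qed

lemma mps_inverse:
  fixes f :: "('v, 'a::field) mps"
  assumes "mps_nth f 0 \<noteq> 0"
  shows "f * inverse f = 1"
proof -
  define c where "c = mps_nth f 0"
  define u where "u = 1 - mps_const (1 / c) * f"
  define S where "S N = (\<Sum>k\<le>N. u ^ k)" for N
  define g where "g = Abs_mps (\<lambda>m. mps_nth (S (mdeg m)) m)"
  have c: "c \<noteq> 0" using assms by (simp add: c_def)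
  have u0: "mps_nth u 0 = 0"
    using c by (simp add: u_def minus_mps_def one_mps_def mps_const_mult c_def)
  have g: "mps_nth g b = mps_nth (S N) b" if "mdeg b \<le> N" for b N
  proof -
    have "(\<Sum>k\<le>mdeg b. mps_nth (u ^ k) b) = (\<Sum>k\<le>N. mps_nth (u ^ k) b)"
      using that by (intro sum.mono_neutral_left) (auto intro: mps_nth_power_low[OF u0])
    then show ?thesis by (simp add: g_def S_def mps_nth_sum)
  qed
  have "(1 - u) * g = 1"
  proof (rule mps_eqI)
    fix m
    have "mps_nth ((1 - u) * g) m = mps_nth ((1 - u) * S (mdeg m)) m"
      unfolding times_mps_def mps_nth_Abs
      by (rule sum.cong) (auto simp: mdeg_add intro!: arg_cong2[where f = "(*)"] g)
    also have "\<dots> = mps_nth (1 - u ^ Suc (mdeg m)) m"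
      unfolding S_def by (simp only: sum_gp_basic)
    also have "\<dots> = mps_nth 1 m"
      unfolding minus_mps_def using mps_nth_power_low[OF u0, of m "Suc (mdeg m)"] by simp
    finally show "mps_nth ((1 - u) * g) m = mps_nth 1 m" .
  qed
  then have ex: "f * (mps_const (1 / c) * g) = 1"
    by (simp add: u_def ac_simps)
  have "(THE g. f * g = 1) = mps_const (1 / c) * g"
  proof (rule the_equality)
    fix h assume h: "f * h = 1"
    have "h = h * (f * (mps_const (1 / c) * g))" by (simp only: ex mult_1_right)
    also have "\<dots> = (f * h) * (mps_const (1 / c) * g)" by (simp only: ac_simps)
    also have "\<dots> = mps_const (1 / c) * g" by (simp only: h mult_1_left)
    finally show "h = mps_const (1 / c) * g" .
  qed (rule ex)
  then show ?thesis using assms ex by (simp add: inverse_mps_def)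
qed


section \<open>The equivariant Hilbert series\<close>

text \<open>Names of the variables \<open>s\<^sub>1, s\<^sub>2, \<dots>\<close> and \<open>t\<close>.\<close>

datatype st_var = S nat | T

text \<open>
  The coefficient of \<open>s\<^sub>1\<^bsup>n\<^sub>1\<^esup> \<cdots> s\<^sub>q\<^bsup>n\<^sub>q\<^esup> t\<^bsup>d\<^esup>\<close> is the Hilbert function of the \<open>n\<close>-th quotient at \<open>d\<close>.
  Exponent vectors in which some \<open>n\<^sub>j\<close> with \<open>j\<close> in \<open>{1..q}\<close> vanishes, or in which a variable
  \<open>s\<^sub>j\<close> with \<open>j\<close> outside \<open>{1..q}\<close> occurs, do not contribute.
\<close>

definition equivH ::
  "nat \<Rightarrow> (nat \<Rightarrow> nat) \<Rightarrow> ((nat \<Rightarrow> nat) \<Rightarrow> (xvar, 'k::field) mpoly set) \<Rightarrow> (st_var, complex) mps" where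
  "equivH q c I = Abs_mps (\<lambda>e.
     if \<forall>j. j \<in> {1..q} \<longleftrightarrow> Poly_Mapping.lookup e (S j) \<ge> 1
     then let n = (\<lambda>j\<in>{1..q}. Poly_Mapping.lookup e (S j)); d = Poly_Mapping.lookup e T
          in of_nat (hilbert_fun (xvars q c n) (I n) d)
     else 0)"

text \<open>
  The embedding of the power series in \<open>s\<^sub>1, s\<^sub>2, \<dots>, t\<close> into the power series in the formal roots
  \<open>r\<^sub>j = s\<^sub>j\<^bsup>1/c\<^sub>j\<^esup>\<close> and \<open>t\<close>, i.e. the substitution of \<open>r\<^sub>j\<^bsup>c\<^sub>j\<^esup>\<close> for \<open>s\<^sub>j\<close>. In the target, the variable
  named \<open>S j\<close> is \<open>r\<^sub>j\<close>.
\<close>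

fun root_index :: "(nat \<Rightarrow> nat) \<Rightarrow> st_var \<Rightarrow> nat" where
  "root_index c (S j) = c j"
| "root_index c T = 1"

definition root_embed :: "(nat \<Rightarrow> nat) \<Rightarrow> (st_var, 'a::comm_ring_1) mps \<Rightarrow> (st_var, 'a) mps" where
  "root_embed c f = Abs_mps (\<lambda>e.
     if \<forall>v. root_index c v dvd Poly_Mapping.lookup e v
     then mps_nth f (Poly_Mapping.mapp (\<lambda>v a. a div root_index c v) e)
     else 0)"

definition primitive_root_of_unity :: "nat \<Rightarrow> complex \<Rightarrow> bool" where
  "primitive_root_of_unity n w \<longleftrightarrow> w ^ n = 1 \<and> (\<forall>k\<in>{1..<n}. w ^ k \<noteq> 1)"

end

theory Submission
  imports Defs "HOL-Library.Multiset"
begin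

text \<open>
  Modulo \<open>I\<^sub>n\<close>, the monomials in the \<open>x\<^bsub>i,k\<^esub>\<close> are identified exactly when they have the same image
  under \<open>\<Phi>\<^sub>n\<close>, and distinct images are linearly independent. The Hilbert function at \<open>d\<close> therefore
  counts the image monomials of degree \<open>d\<close> (\<open>hilbert_fun_kernel_pushforward\<close>). The image of a product
  of \<open>d\<close> variables consists of one block for each \<open>j\<close>, a multiset of \<open>d\<close> pairs in
  \<open>[c\<^sub>j] \<times> [n\<^sub>j]\<close>, and since the variables \<open>x\<^bsub>i,k\<^esub>\<close> combine all pairs freely, every family of such
  multisets occurs (\<open>image_monomials_eq_blocks\<close>). Hence the dimension is the product of the binomial
  coefficients \<open>(c\<^sub>j n\<^sub>j + d - 1) choose d\<close> (\<open>hilbert_fun_toric_ideal\<close>).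

  On the other side, let \<open>r\<^sub>j\<close> be the formal root of \<open>s\<^sub>j\<close> and \<open>a\<^sub>j = \<omega>\<^sub>j ^ m\<^sub>j\<close>. A summand is the product of
  the \<open>a\<^sub>j r\<^sub>j\<close> divided by \<open>P - t\<close> with \<open>P\<close> the product of the \<open>1 - a\<^sub>j r\<^sub>j\<close>; its coefficient at
  \<open>r\<^sub>1\<^bsup>N\<^sub>1\<^esup> \<cdots> r\<^sub>q\<^bsup>N\<^sub>q\<^esup> t\<^bsup>d\<^esup>\<close> is the product of the \<open>((N\<^sub>j - 1 + d) choose d) * a\<^sub>j ^ N\<^sub>j\<close> when all \<open>N\<^sub>j\<close> are
  positive (\<open>rational_summand\<close>). Averaging over the roots of unity deletes the terms in which some
  \<open>N\<^sub>j\<close> is not a multiple of \<open>c\<^sub>j\<close> (\<open>average_over_roots\<close>). What remains, with \<open>N\<^sub>j = c\<^sub>j n\<^sub>j\<close>, is the Hilbert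
  function just computed.
\<close>

section \<open>Pushforward of polynomials along a map of exponents\<close>

text \<open>
  Pushing the exponents of a polynomial forward along \<open>E\<close>. For additive \<open>E\<close> this is the map
  of monoid algebras induced by \<open>E\<close>; every substitution of monomials for variables has this form
  (\<open>poly_subst_monomials\<close> below), and here its effect on coefficients is visible.
\<close>

definition pushforward :: "('v monomial \<Rightarrow> 'w monomial) \<Rightarrow> ('v, 'k::comm_ring_1) mpoly \<Rightarrow> ('w, 'k) mpoly" where
  "pushforward E p = (\<Sum>m\<in>Poly_Mapping.keys p. Poly_Mapping.single (E m) (Poly_Mapping.lookup p m))"

lemma pushforward_zero [simp]: "pushforward E 0 = 0"
  by (simp add: pushforward_def)

lemma pushforward_single [simp]: "pushforward E (Poly_Mapping.single m a) = Poly_Mapping.single (E m) a"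
  by (cases "a = 0") (auto simp: pushforward_def)

lemma pushforward_add: "pushforward E (p + q) = pushforward E p + pushforward E q"
  unfolding pushforward_def by (rule setsum_keys_plus_distrib) (auto simp: single_add)

lemma pushforward_uminus: "pushforward E (- p) = - pushforward E p"
  using pushforward_add[of E p "- p"] by (simp add: eq_neg_iff_add_eq_0 add.commute)

lemma pushforward_diff: "pushforward E (p - q) = pushforward E p - pushforward E q"
  using pushforward_add[of E p "- q"] by (simp add: pushforward_uminus)

lemma pushforward_sum: "pushforward E (\<Sum>i\<in>A. p i) = (\<Sum>i\<in>A. pushforward E (p i))"
  by (induction A rule: infinite_finite_induct) (auto simp: pushforward_add)

lemma sum_single_keys: "(\<Sum>m\<in>Poly_Mapping.keys p. Poly_Mapping.single m (Poly_Mapping.lookup p m)) = p"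
  by (rule poly_mapping_eqI)
     (auto simp: lookup_sum lookup_single when_def in_keys_iff sum.delta)

lemma pushforward_mult:
  assumes "\<And>a b. E (a + b) = E a + E b"
  shows "pushforward E (p * q) = pushforward E p * pushforward E q"
proof -
  let ?s = "\<lambda>p m. Poly_Mapping.single m (Poly_Mapping.lookup p m)"
  have "p * q = (\<Sum>a\<in>Poly_Mapping.keys p. \<Sum>b\<in>Poly_Mapping.keys q. ?s p a * ?s q b)"
    by (simp only: sum_product[symmetric] sum_single_keys)
  then show ?thesis
    by (simp add: pushforward_sum mult_single assms) (simp add: pushforward_def sum_product mult_single)
qed

lemma keys_pushforward: "Poly_Mapping.keys (pushforward E p) \<subseteq> E ` Poly_Mapping.keys p"
  unfolding pushforward_def
  by (intro order_trans[OF Poly_Mapping.keys_sum]) (auto split: if_splits)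

section \<open>Rings of polynomials in a set of variables\<close>

lemma carrier_poly_ring:
  "p \<in> carrier (poly_ring V) \<longleftrightarrow> (\<forall>m\<in>Poly_Mapping.keys p. Poly_Mapping.keys m \<subseteq> V)"
  by (simp add: poly_ring_def)

lemma poly_ring_simps [simp]:
  "monoid.mult (poly_ring V) = (*)" "one (poly_ring V) = 1" "zero (poly_ring V) = 0" "add (poly_ring V) = (+)"
  by (simp_all add: poly_ring_def)

lemma cring_poly_ring: "cring (poly_ring V :: ('v, 'k::comm_ring_1) mpoly ring)"
proof (intro cringI abelian_groupI comm_monoidI)
  fix x y :: "('v, 'k) mpoly"
  assume x: "x \<in> carrier (poly_ring V)" and y: "y \<in> carrier (poly_ring V)"
  show "x \<oplus>\<^bsub>poly_ring V\<^esub> y \<in> carrier (poly_ring V)"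
    using x y Poly_Mapping.keys_add[of x y] by (auto simp: carrier_poly_ring)
  show "x \<otimes>\<^bsub>poly_ring V\<^esub> y \<in> carrier (poly_ring V)"
    unfolding carrier_poly_ring
  proof
    fix m assume "m \<in> Poly_Mapping.keys (x \<otimes>\<^bsub>poly_ring V\<^esub> y)"
    then obtain a b where "m = a + b" "a \<in> Poly_Mapping.keys x" "b \<in> Poly_Mapping.keys y"
      using Poly_Mapping.keys_mult[of x y] by auto
    then show "Poly_Mapping.keys m \<subseteq> V"
      using x y Poly_Mapping.keys_add[of a b] unfolding carrier_poly_ring by blast
  qed
  show "\<exists>y\<in>carrier (poly_ring V). y \<oplus>\<^bsub>poly_ring V\<^esub> x = \<zero>\<^bsub>poly_ring V\<^esub>"
    using x by (intro bexI[of _ "- x"]) (auto simp: carrier_poly_ring in_keys_iff)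
qed (auto simp: carrier_poly_ring algebra_simps)

lemma subfield_Const: "subfield (range Const) (poly_ring V :: ('v, 'k::field) mpoly ring)"
proof -
  interpret cring "poly_ring V :: ('v, 'k) mpoly ring" by (rule cring_poly_ring)
  have inv: "\<ominus>\<^bsub>poly_ring V\<^esub> Const a = Const (- a)" for a :: 'k
    by (rule minus_equality) (auto simp: Const_def carrier_poly_ring single_add[symmetric])
  have mult: "Const a * Const b = (Const (a * b) :: ('v, 'k) mpoly)" for a b
    by (simp add: Const_def mult_single)
  have plus: "Const a + Const b = (Const (a + b) :: ('v, 'k) mpoly)" for a b
    by (simp add: Const_def single_add)
  have carrier_Const: "Const a \<in> carrier (poly_ring V)" for a :: 'k
    by (simp add: Const_def carrier_poly_ring)
  have Const_1: "Const 1 = (1 :: ('v, 'k) mpoly)" by (simp add: Const_def)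
  have "subring (range Const) (poly_ring V :: ('v, 'k) mpoly ring)"
  proof (rule subringI)
    show "\<one>\<^bsub>poly_ring V\<^esub> \<in> range (Const :: 'k \<Rightarrow> ('v, 'k) mpoly)"
      by (simp flip: Const_1)
  qed (auto simp: inv mult plus carrier_Const)
  then have sub: "subcring (range Const) (poly_ring V :: ('v, 'k) mpoly ring)"
    by (rule subcringI) (auto simp: mult mult.commute)
  have unit: "\<exists>b. a * b = 1" if "Const a \<noteq> (0 :: ('v, 'k) mpoly)" for a :: 'k
    using that by (intro exI[of _ "inverse a"]) (cases "a = 0"; auto simp: Const_def)
  show ?thesis
  proof (rule subfieldI[OF sub])
    show "Units (poly_ring V \<lparr>carrier := range Const\<rparr>) = range Const - {\<zero>\<^bsub>(poly_ring V :: ('v, 'k) mpoly ring)\<^esub>}"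
      unfolding Units_def using unit
      by (auto simp: mult simp flip: Const_1) (metis Const_1 mult mult.commute mult_zero_left zero_neq_one)+
  qed
qed

lemma ring_hom_pushforward:
  assumes add: "\<And>a b. E (a + b) = E a + E b" and zero: "E 0 = 0"
    and V: "\<And>m. Poly_Mapping.keys m \<subseteq> V \<Longrightarrow> Poly_Mapping.keys (E m) \<subseteq> W"
  shows "ring_hom_ring (poly_ring V) (poly_ring W) (pushforward E :: ('v, 'k::field) mpoly \<Rightarrow> ('w, 'k) mpoly)"
proof (rule ring_hom_ringI2)
  show "ring (poly_ring V :: ('v, 'k) mpoly ring)" "ring (poly_ring W :: ('w, 'k) mpoly ring)"
    using cring_poly_ring cring.axioms(1) by blast+
  show "pushforward E \<in> ring_hom (poly_ring V) (poly_ring W :: ('w, 'k) mpoly ring)"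
  proof (rule ring_hom_memI)
    fix p :: "('v, 'k) mpoly" assume "p \<in> carrier (poly_ring V)"
    then show "pushforward E p \<in> carrier (poly_ring W)"
      using keys_pushforward[of E p] V unfolding carrier_poly_ring by blast
  next
    show "pushforward E \<one>\<^bsub>poly_ring V\<^esub> = \<one>\<^bsub>(poly_ring W :: ('w, 'k) mpoly ring)\<^esub>"
      using pushforward_single[of E 0 "1::'k"] by (simp add: zero)
  qed (auto simp: pushforward_mult[OF add] pushforward_add)
qed

section \<open>The Hilbert function of a toric ring\<close>

text \<open>
  Modulo the kernel, a polynomial is determined by its pushforward. Enlarging the set \<open>B\<close> of
  permitted exponents by one exponent \<open>b = E m\<close> therefore adds exactly one dimension, spanned by the
  class of the monomial \<open>m\<close>: the multiple of it to be subtracted from a given \<open>p\<close> is dictated by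
  the coefficient of \<open>b\<close> in the pushforward of \<open>p\<close>. Formulating the spaces through pushforwards,
  rather than as spans of chosen monomials, makes linear independence a comparison of supports.
\<close>

lemma dimension_quotient_pushforward:
  fixes E :: "'v monomial \<Rightarrow> 'w monomial" and V :: "'v set" and W :: "'w set"
  defines "R \<equiv> poly_ring V :: ('v, 'k::field) mpoly ring"
  defines "I \<equiv> a_kernel R (poly_ring W) (pushforward E)"
  assumes hom: "ring_hom_ring R (poly_ring W) (pushforward E :: ('v, 'k) mpoly \<Rightarrow> ('w, 'k) mpoly)"
    and fin: "finite B" and B: "B \<subseteq> E ` {m. Poly_Mapping.keys m \<subseteq> V}"
  shows "ring.dimension (R Quot I) (card B) ((\<lambda>a. I +>\<^bsub>R\<^esub> Const a) ` UNIV)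
           ((\<lambda>p. I +>\<^bsub>R\<^esub> p) ` {p \<in> carrier R. Poly_Mapping.keys (pushforward E p) \<subseteq> B})"
proof -
  interpret hom: ring_hom_ring R "poly_ring W" "pushforward E :: ('v, 'k) mpoly \<Rightarrow> ('w, 'k) mpoly" by (rule hom)
  interpret ideal I R unfolding I_def by (rule hom.kernel_is_ideal)
  interpret Q: ring "R Quot I" by (rule quotient_is_ring)
  have rh: "(+>\<^bsub>R\<^esub>) I \<in> ring_hom R (R Quot I)" by (rule rcos_ring_hom)
  have Rs: "monoid.mult R = (*)" "add R = (+)" "zero R = 0" by (simp_all add: R_def)
  have coset_eq: "I +>\<^bsub>R\<^esub> p = I +>\<^bsub>R\<^esub> q \<longleftrightarrow> pushforward E p = pushforward E q"
    if "p \<in> carrier R" "q \<in> carrier R" for p q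
    using that hom.rcos_eq_homeq[of p] hom.rcos_eq_homeq[of q] a_rcos_self[of p]
    unfolding I_def by auto
  have diff: "p - q \<in> carrier R" if "p \<in> carrier R" "q \<in> carrier R" for p q
    using that keys_diff[of p q] unfolding R_def carrier_poly_ring by blast
  from fin B show ?thesis
  proof (induction B rule: finite_induct)
    case empty
    have "{p \<in> carrier R. Poly_Mapping.keys (pushforward E p) \<subseteq> {}} = I"
      unfolding I_def a_kernel_def' by auto
    moreover have "(\<lambda>p. I +>\<^bsub>R\<^esub> p) ` I = {\<zero>\<^bsub>R Quot I\<^esub>}"
    proof -
      have "I +>\<^bsub>R\<^esub> p = I" if "p \<in> I" for p
        using that a_rcos_const by blast
      moreover have "I \<noteq> {}"
        using additive_subgroup.zero_closed is_additive_subgroup by blast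
      ultimately show ?thesis by (auto simp: FactRing_def)
    qed
    ultimately show ?case using Q.zero_dim by simp
  next
    case (insert b B)
    then obtain m where m: "Poly_Mapping.keys m \<subseteq> V" "b = E m" by auto
    let ?S = "\<lambda>B. (\<lambda>p. I +>\<^bsub>R\<^esub> p) ` {p \<in> carrier R. Poly_Mapping.keys (pushforward E p) \<subseteq> B}"
    let ?K = "(\<lambda>a. I +>\<^bsub>R\<^esub> Const a) ` UNIV"
    let ?x = "Poly_Mapping.single m 1 :: ('v, 'k) mpoly"
    have x: "?x \<in> carrier R" using m by (simp add: R_def carrier_poly_ring)
    have C: "Const a \<in> carrier R" for a by (simp add: R_def carrier_poly_ring Const_def)
    have ax: "Const a * ?x = Poly_Mapping.single m a" for a by (simp add: Const_def mult_single)
    have axR: "Poly_Mapping.single m a \<in> carrier R" for a using m by (auto simp: R_def carrier_poly_ring)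
    have comb: "(I +>\<^bsub>R\<^esub> Const a) \<otimes>\<^bsub>R Quot I\<^esub> (I +>\<^bsub>R\<^esub> ?x) \<oplus>\<^bsub>R Quot I\<^esub> (I +>\<^bsub>R\<^esub> p)
        = I +>\<^bsub>R\<^esub> (Poly_Mapping.single m a + p)" if p: "p \<in> carrier R" for a p
      using ring_hom_mult[OF rh C x, of a] ring_hom_add[OF rh axR p, of a] ax by (simp add: Rs)
    have "Q.line_extension ?K (I +>\<^bsub>R\<^esub> ?x) (?S B) = ?S (insert b B)"
    proof (intro equalityI subsetI)
      fix u assume "u \<in> Q.line_extension ?K (I +>\<^bsub>R\<^esub> ?x) (?S B)"
      then obtain a p where p: "p \<in> carrier R" "Poly_Mapping.keys (pushforward E p) \<subseteq> B"
        and u: "u = I +>\<^bsub>R\<^esub> (Poly_Mapping.single m a + p)"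
        unfolding Q.line_extension_mem_iff using comb by auto
      have "Poly_Mapping.single m a + p \<in> carrier R"
        using hom.R.add.m_closed[OF axR p(1)] by (simp add: Rs)
      moreover have "Poly_Mapping.keys (pushforward E (Poly_Mapping.single m a + p)) \<subseteq> insert b B"
        using p(2) Poly_Mapping.keys_add[of "Poly_Mapping.single (E m) a" "pushforward E p"] m(2)
        by (auto simp: pushforward_add split: if_splits)
      ultimately show "u \<in> ?S (insert b B)" using u by blast
    next
      fix u assume "u \<in> ?S (insert b B)"
      then obtain p where p: "p \<in> carrier R" "Poly_Mapping.keys (pushforward E p) \<subseteq> insert b B"
        and u: "u = I +>\<^bsub>R\<^esub> p" by auto
      \<comment> \<open>Subtracting this multiple of the new basis vector removes the exponent from the pushforward.\<close>
      define a where "a = Poly_Mapping.lookup (pushforward E p) b"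
      define p' where "p' = p - Poly_Mapping.single m a"
      have "p' \<in> carrier R" unfolding p'_def by (intro diff p axR)
      moreover have "Poly_Mapping.keys (pushforward E p') \<subseteq> B"
      proof
        fix k assume k: "k \<in> Poly_Mapping.keys (pushforward E p')"
        have "Poly_Mapping.lookup (pushforward E p') k = Poly_Mapping.lookup (pushforward E p) k - (a when b = k)"
          by (simp add: p'_def pushforward_diff lookup_minus lookup_single m(2))
        with k have "k \<noteq> b \<and> k \<in> Poly_Mapping.keys (pushforward E p)"
          by (auto simp: in_keys_iff a_def when_def split: if_splits)
        with p(2) show "k \<in> B" by auto
      qed
      moreover have "u = I +>\<^bsub>R\<^esub> (Poly_Mapping.single m a + p')" by (simp add: u p'_def)
      ultimately show "u \<in> Q.line_extension ?K (I +>\<^bsub>R\<^esub> ?x) (?S B)"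
        unfolding Q.line_extension_mem_iff using comb[of p' a] by blast
    qed
    moreover have "I +>\<^bsub>R\<^esub> ?x \<notin> ?S B"
    proof
      assume "I +>\<^bsub>R\<^esub> ?x \<in> ?S B"
      then obtain p where "p \<in> carrier R" "Poly_Mapping.keys (pushforward E p) \<subseteq> B"
          "I +>\<^bsub>R\<^esub> ?x = I +>\<^bsub>R\<^esub> p" by auto
      then have "Poly_Mapping.keys (pushforward E ?x) \<subseteq> B" using coset_eq x by simp
      then show False using insert.hyps m(2) by simp
    qed
    moreover have "I +>\<^bsub>R\<^esub> ?x \<in> carrier (R Quot I)" using ring_hom_closed[OF rh x] .
    ultimately show ?case
      using Q.Suc_dim[of "I +>\<^bsub>R\<^esub> ?x" "?S B" "card B" ?K] insert by simp
  qed
qed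

text \<open>
  A toric ring has the images of monomials as a basis, so its Hilbert function counts the distinct
  image exponents. A class lies in degree \<open>d\<close> as soon as its pushforward is supported on
  images of monomials of degree \<open>d\<close>, because replacing each image exponent by a preimage of that
  degree yields a homogeneous representative.
\<close>

lemma hilbert_fun_kernel_pushforward:
  fixes E :: "'v monomial \<Rightarrow> 'w monomial" and V :: "'v set" and W :: "'w set"
  assumes E0: "E 0 = 0" and add: "\<And>a b. E (a + b) = E a + E b"
    and V: "\<And>m. Poly_Mapping.keys m \<subseteq> V \<Longrightarrow> Poly_Mapping.keys (E m) \<subseteq> W"
    and fin: "finite (E ` {m. Poly_Mapping.keys m \<subseteq> V \<and> mdeg m = d})"
  shows "hilbert_fun V
      (a_kernel (poly_ring V) (poly_ring W) (pushforward E :: ('v, 'k::field) mpoly \<Rightarrow> ('w, 'k) mpoly)) d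
    = card (E ` {m. Poly_Mapping.keys m \<subseteq> V \<and> mdeg m = d})"
proof -
  define R where "R = (poly_ring V :: ('v, 'k) mpoly ring)"
  define I where "I = a_kernel R (poly_ring W) (pushforward E :: ('v, 'k) mpoly \<Rightarrow> ('w, 'k) mpoly)"
  define B where "B = E ` {m. Poly_Mapping.keys m \<subseteq> V \<and> mdeg m = d}"
  have hom: "ring_hom_ring R (poly_ring W) (pushforward E :: ('v, 'k) mpoly \<Rightarrow> ('w, 'k) mpoly)"
    unfolding R_def using add E0 V by (rule ring_hom_pushforward)
  interpret hom: ring_hom_ring R "poly_ring W" "pushforward E :: ('v, 'k) mpoly \<Rightarrow> ('w, 'k) mpoly" by (rule hom)
  interpret ideal I R unfolding I_def by (rule hom.kernel_is_ideal)
  interpret Q: ring "R Quot I" by (rule quotient_is_ring)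
  interpret proj: ring_hom_ring R "R Quot I" "(+>\<^bsub>R\<^esub>) I" by (rule rcos_ring_hom_ring)
  have "\<one>\<^bsub>R\<^esub> \<notin> I"
    unfolding I_def a_kernel_def' using hom.hom_one by auto
  then have "\<one>\<^bsub>R Quot I\<^esub> \<noteq> \<zero>\<^bsub>R Quot I\<^esub>"
    using a_rcos_self[OF hom.R.one_closed] unfolding FactRing_def by fastforce
  then have K: "subfield ((\<lambda>a. I +>\<^bsub>R\<^esub> Const a) ` UNIV) (R Quot I)"
    using proj.img_is_subfield(2)[of "range Const"] subfield_Const[of V]
    unfolding R_def by (simp add: image_image)
  have S: "(\<lambda>p. I +>\<^bsub>R\<^esub> p) ` {p \<in> carrier R. homogeneous d p} =
      (\<lambda>p. I +>\<^bsub>R\<^esub> p) ` {p \<in> carrier R. Poly_Mapping.keys (pushforward E p) \<subseteq> B}"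
  proof (intro equalityI subsetI)
    fix u assume "u \<in> (\<lambda>p. I +>\<^bsub>R\<^esub> p) ` {p \<in> carrier R. homogeneous d p}"
    then show "u \<in> (\<lambda>p. I +>\<^bsub>R\<^esub> p) ` {p \<in> carrier R. Poly_Mapping.keys (pushforward E p) \<subseteq> B}"
      using keys_pushforward[of E] unfolding R_def B_def homogeneous_def carrier_poly_ring by blast
  next
    fix u assume "u \<in> (\<lambda>p. I +>\<^bsub>R\<^esub> p) ` {p \<in> carrier R. Poly_Mapping.keys (pushforward E p) \<subseteq> B}"
    then obtain p where p: "p \<in> carrier R" "Poly_Mapping.keys (pushforward E p) \<subseteq> B" and u: "u = I +>\<^bsub>R\<^esub> p"
      by auto
    define r where "r = inv_into {m. Poly_Mapping.keys m \<subseteq> V \<and> mdeg m = d} E"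
    have r: "Poly_Mapping.keys (r b) \<subseteq> V \<and> mdeg (r b) = d \<and> E (r b) = b" if "b \<in> B" for b
      using inv_into_into[OF that[unfolded B_def]] f_inv_into_f[OF that[unfolded B_def]]
      unfolding r_def by simp
    define p' where "p' = (\<Sum>b\<in>Poly_Mapping.keys (pushforward E p).
      Poly_Mapping.single (r b) (Poly_Mapping.lookup (pushforward E p) b))"
    have "Poly_Mapping.keys p' \<subseteq> r ` B"
      unfolding p'_def using p(2) by (intro order_trans[OF Poly_Mapping.keys_sum]) (auto split: if_splits)
    then have p': "p' \<in> carrier R" "homogeneous d p'"
      using r unfolding R_def carrier_poly_ring homogeneous_def by blast+
    have "pushforward E p' = (\<Sum>b\<in>Poly_Mapping.keys (pushforward E p).
        Poly_Mapping.single b (Poly_Mapping.lookup (pushforward E p) b))"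
      unfolding p'_def pushforward_sum using p(2) r by (intro sum.cong) auto
    then have "pushforward E p' = pushforward E p" by (simp add: sum_single_keys)
    then have "I +>\<^bsub>R\<^esub> p' = I +>\<^bsub>R\<^esub> p"
      unfolding I_def using hom.rcos_eq_homeq p p' by simp
    then show "u \<in> (\<lambda>p. I +>\<^bsub>R\<^esub> p) ` {p \<in> carrier R. homogeneous d p}" using p' u by auto
  qed
  have "Q.dimension (card B) ((\<lambda>a. I +>\<^bsub>R\<^esub> Const a) ` UNIV)
     ((\<lambda>p. I +>\<^bsub>R\<^esub> p) ` {p \<in> carrier R. homogeneous d p})"
    unfolding S unfolding R_def I_def
    by (rule dimension_quotient_pushforward) (use hom fin in \<open>auto simp: R_def B_def\<close>)
  from Q.dimI[OF K this] show ?thesis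
    unfolding hilbert_fun_def R_def[symmetric] I_def[symmetric] B_def[symmetric] over_def .
qed

section \<open>Substitution of monomials\<close>

text \<open>
  The repeated sum replaces a scalar multiplication by natural numbers; it keeps additivity in the
  exponents an instance of the concatenation law for replicated lists.
\<close>

definition mono_subst :: "('v \<Rightarrow> 'w monomial) \<Rightarrow> 'v monomial \<Rightarrow> 'w monomial" where
  "mono_subst e m = (\<Sum>v\<in>Poly_Mapping.keys m. sum_list (replicate (Poly_Mapping.lookup m v) (e v)))"

lemma mono_subst_zero [simp]: "mono_subst e 0 = 0"
  by (simp add: mono_subst_def)

lemma mono_subst_add: "mono_subst e (a + b) = mono_subst e a + mono_subst e b"
  unfolding mono_subst_def by (rule setsum_keys_plus_distrib) (auto simp: replicate_add)

lemma mono_subst_single [simp]: "mono_subst e (Poly_Mapping.single v 1) = e v"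
  by (simp add: mono_subst_def)

lemma power_single_one:
  "Poly_Mapping.single x (1 :: 'k::comm_ring_1) ^ n = Poly_Mapping.single (sum_list (replicate n x)) 1"
  by (induction n) (auto simp: mult_single)

lemma prod_single_one:
  "(\<Prod>i\<in>A. Poly_Mapping.single (f i) (1 :: 'k::comm_ring_1)) = Poly_Mapping.single (\<Sum>i\<in>A. f i) 1"
  by (induction A rule: infinite_finite_induct) (auto simp: mult_single)

lemma poly_subst_monomials:
  "poly_subst (\<lambda>v. Poly_Mapping.single (e v) 1) = pushforward (mono_subst e)"
  by (rule ext)
     (simp add: poly_subst_def pushforward_def mono_subst_def power_single_one prod_single_one Const_def mult_single)

section \<open>The toric rings of the hierarchical models\<close>

lemma monomial_split_variable:
  assumes "mdeg m = Suc d"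
  obtains v m' where "m = m' + Poly_Mapping.single v 1" "mdeg m' = d"
    "Poly_Mapping.keys m = insert v (Poly_Mapping.keys m')"
proof -
  from assms have "m \<noteq> 0" by (auto simp: mdeg_def)
  then obtain v where v: "v \<in> Poly_Mapping.keys m" by (auto simp flip: keys_eq_empty)
  define m' where "m' = m - Poly_Mapping.single v 1"
  have m: "m = m' + Poly_Mapping.single v 1"
    using v by (intro poly_mapping_eqI) (auto simp: m'_def lookup_add lookup_minus lookup_single when_def in_keys_iff)
  moreover have "mdeg m' = d"
    using assms unfolding m mdeg_add by (simp add: mdeg_def)
  moreover have "Poly_Mapping.keys m = insert v (Poly_Mapping.keys m')"
    unfolding m by (auto simp: in_keys_iff lookup_add lookup_single when_def split: if_splits)
  ultimately show ?thesis using that by blast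
qed

definition block_exponent :: "nat \<Rightarrow> xvar \<Rightarrow> yvar monomial" where
  "block_exponent q = (\<lambda>(i, k). \<Sum>j=1..q. Poly_Mapping.single (j, i j, k j) 1)"

lemma Phi_eq_pushforward: "Phi q = pushforward (mono_subst (block_exponent q))"
  unfolding Phi_def poly_subst_monomials[symmetric]
  by (simp add: block_exponent_def Var_def prod_single_one case_prod_unfold)

text \<open>
  The exponent of a monomial in the \<open>y\<^bsub>j,i,k\<^esub>\<close> splits into \<open>q\<close> independent blocks, one for each
  \<open>j\<close>; a block is encoded as the multiset of its index pairs \<open>(i, k)\<close>, so that the counting of
  multisets applies to it.
\<close>

definition of_blocks :: "nat \<Rightarrow> (nat \<Rightarrow> (nat \<times> nat) multiset) \<Rightarrow> yvar monomial" where
  "of_blocks q F = Abs_poly_mapping (\<lambda>(j, a). if j \<in> {1..q} then count (F j) a else 0)"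

lemma lookup_of_blocks:
  "Poly_Mapping.lookup (of_blocks q F) (j, a) = (if j \<in> {1..q} then count (F j) a else 0)"
proof -
  have "{x. (case x of (j, a) \<Rightarrow> if j \<in> {1..q} then count (F j) a else 0) \<noteq> 0}
      \<subseteq> (SIGMA j:{1..q}. set_mset (F j))" by (auto split: if_splits)
  moreover have "finite (SIGMA j:{1..q}. set_mset (F j))" by auto
  ultimately have "finite {x. (case x of (j, a) \<Rightarrow> if j \<in> {1..q} then count (F j) a else 0) \<noteq> 0}"
    by (rule finite_subset)
  then show ?thesis unfolding of_blocks_def by simp
qed

lemma inj_of_blocks: "inj_on (of_blocks q) (PiE {1..q} B)"
proof (rule inj_onI)
  fix F G assume F: "F \<in> PiE {1..q} B" and G: "G \<in> PiE {1..q} B" and eq: "of_blocks q F = of_blocks q G"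
  show "F = G"
  proof (rule PiE_ext[OF F G])
    fix j assume "j \<in> {1..q}"
    then show "F j = G j"
      by (intro multiset_eqI) (metis eq lookup_of_blocks)
  qed
qed

lemma of_blocks_empty: "of_blocks q (\<lambda>_. {#}) = 0"
  by (rule poly_mapping_eqI) (auto simp: lookup_of_blocks)

lemma of_blocks_cong: "(\<And>j. j \<in> {1..q} \<Longrightarrow> F j = G j) \<Longrightarrow> of_blocks q F = of_blocks q G"
  unfolding of_blocks_def by (auto intro!: arg_cong[of _ _ Abs_poly_mapping])

lemma of_blocks_add_mset:
  "of_blocks q (\<lambda>j. add_mset (i j, k j) (F j)) = of_blocks q F + block_exponent q (i, k)"
proof (rule poly_mapping_eqI)
  fix x :: yvar
  obtain j a where x: "x = (j, a)" by (cases x)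
  have "Poly_Mapping.lookup (block_exponent q (i, k)) (j, a) =
      (\<Sum>j'\<in>{1..q}. if j' = j then (if a = (i j, k j) then 1 else 0) else 0)"
    unfolding block_exponent_def prod.case lookup_sum
    by (rule sum.cong) (auto simp: lookup_single when_def)
  then show "Poly_Mapping.lookup (of_blocks q (\<lambda>j. add_mset (i j, k j) (F j))) x =
      Poly_Mapping.lookup (of_blocks q F + block_exponent q (i, k)) x"
    unfolding x by (auto simp: lookup_add lookup_of_blocks)
qed

text \<open>
  Any \<open>q\<close> multisets of index pairs, all of size \<open>d\<close>, come from a monomial of degree \<open>d\<close>: pick
  one pair from each multiset; together these pairs are the indices of a single variable
  \<open>x\<^bsub>i,k\<^esub>\<close>, and removing them leaves multisets of size \<open>d - 1\<close>. So the blocks of an image exponent are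
  constrained only by having the same size, and this turns the count into a product.
\<close>

lemma image_monomials_eq_blocks:
  "mono_subst (block_exponent q) ` {m. Poly_Mapping.keys m \<subseteq> xvars q c n \<and> mdeg m = d} =
   of_blocks q ` (\<Pi>\<^sub>E j\<in>{1..q}. multisets_of_size ({1..c j} \<times> {1..n j}) d)"
proof (induction d)
  case 0
  have "{m :: xvar monomial. Poly_Mapping.keys m \<subseteq> xvars q c n \<and> mdeg m = 0} = {0}"
    by (auto simp: mdeg_eq_0_iff)
  moreover have "(\<Pi>\<^sub>E j\<in>{1..q}. {{#}}) = {restrict (\<lambda>_. {#} :: (nat \<times> nat) multiset) {1..q}}"
    using PiE_singleton[of "restrict (\<lambda>_. {#} :: (nat \<times> nat) multiset) {1..q}" "{1..q}"]
    by (simp cong: PiE_cong)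
  moreover have "of_blocks q (restrict (\<lambda>_. {#}) {1..q}) = 0"
    unfolding of_blocks_empty[of q, symmetric] by (rule of_blocks_cong) simp
  ultimately show ?case by (simp only: multisets_of_size_0 image_insert image_empty mono_subst_zero)
next
  case (Suc d)
  let ?A = "\<lambda>j. {1..c j} \<times> {1..n j}"
  show ?case
  proof (intro equalityI subsetI)
    fix u assume "u \<in> mono_subst (block_exponent q) ` {m. Poly_Mapping.keys m \<subseteq> xvars q c n \<and> mdeg m = Suc d}"
    then obtain m where m: "Poly_Mapping.keys m \<subseteq> xvars q c n" "mdeg m = Suc d"
      and u: "u = mono_subst (block_exponent q) m" by auto
    obtain v m' where m': "m = m' + Poly_Mapping.single v 1" "mdeg m' = d"
      "Poly_Mapping.keys m = insert v (Poly_Mapping.keys m')" by (rule monomial_split_variable[OF m(2)])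
    obtain i k where v: "v = (i, k)" by (cases v)
    have "mono_subst (block_exponent q) m' \<in> of_blocks q ` (\<Pi>\<^sub>E j\<in>{1..q}. multisets_of_size (?A j) d)"
      using Suc.IH m m' by auto
    then obtain F where F: "F \<in> (\<Pi>\<^sub>E j\<in>{1..q}. multisets_of_size (?A j) d)"
      "mono_subst (block_exponent q) m' = of_blocks q F" by auto
    have ik: "i \<in> box q c" "k \<in> box q n" using m m' v by (auto simp: xvars_def)
    let ?G = "\<lambda>j\<in>{1..q}. add_mset (i j, k j) (F j)"
    have "u = of_blocks q (\<lambda>j. add_mset (i j, k j) (F j))"
      using F(2) unfolding u m' mono_subst_add mono_subst_single v by (simp add: of_blocks_add_mset)
    also have "\<dots> = of_blocks q ?G" by (rule of_blocks_cong) simp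
    finally have "u = of_blocks q ?G" .
    moreover have "?G \<in> (\<Pi>\<^sub>E j\<in>{1..q}. multisets_of_size (?A j) (Suc d))"
      using F(1) ik by (auto simp: multisets_of_size_def box_def PiE_iff)
    ultimately show "u \<in> of_blocks q ` (\<Pi>\<^sub>E j\<in>{1..q}. multisets_of_size (?A j) (Suc d))" by blast
  next
    fix u assume "u \<in> of_blocks q ` (\<Pi>\<^sub>E j\<in>{1..q}. multisets_of_size (?A j) (Suc d))"
    then obtain F where F: "F \<in> (\<Pi>\<^sub>E j\<in>{1..q}. multisets_of_size (?A j) (Suc d))" and u: "u = of_blocks q F"
      by auto
    have "\<exists>a. a \<in># F j" if "j \<in> {1..q}" for j
    proof -
      have "size (F j) = Suc d" using F that by (auto simp: multisets_of_size_def PiE_iff)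
      then show ?thesis by (metis size_eq_Suc_imp_elem)
    qed
    then obtain a where a: "\<And>j. j \<in> {1..q} \<Longrightarrow> a j \<in># F j" by metis
    have aA: "a j \<in> ?A j" if "j \<in> {1..q}" for j
      using F a[OF that] that by (auto simp: multisets_of_size_def PiE_iff)
    define i where "i = (\<lambda>j\<in>{1..q}. fst (a j))"
    define k where "k = (\<lambda>j\<in>{1..q}. snd (a j))"
    define G where "G = (\<lambda>j\<in>{1..q}. F j - {#a j#})"
    have "of_blocks q F = of_blocks q (\<lambda>j. add_mset (i j, k j) (G j))"
      by (rule of_blocks_cong) (simp add: i_def k_def G_def a)
    then have u': "u = of_blocks q G + block_exponent q (i, k)" by (simp add: u of_blocks_add_mset)
    have "G \<in> (\<Pi>\<^sub>E j\<in>{1..q}. multisets_of_size (?A j) d)"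
      using F a unfolding G_def
      by (auto simp: multisets_of_size_def PiE_iff size_Diff_singleton dest!: in_diffD)
    then have "of_blocks q G \<in> mono_subst (block_exponent q) ` {m. Poly_Mapping.keys m \<subseteq> xvars q c n \<and> mdeg m = d}"
      using Suc.IH by blast
    then obtain m where m: "Poly_Mapping.keys m \<subseteq> xvars q c n" "mdeg m = d"
      "of_blocks q G = mono_subst (block_exponent q) m" by auto
    have ik: "(i, k) \<in> xvars q c n"
      using aA by (fastforce simp: xvars_def box_def i_def k_def)
    let ?m = "m + Poly_Mapping.single (i, k) 1"
    have "u = mono_subst (block_exponent q) ?m"
      by (simp only: u' m(3) mono_subst_add mono_subst_single)
    moreover have "Poly_Mapping.keys ?m \<subseteq> xvars q c n"
      using Poly_Mapping.keys_add[of m "Poly_Mapping.single (i, k) 1"] m(1) ik by auto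
    moreover have "mdeg ?m = Suc d"
      using m(2) by (simp only: mdeg_add) (simp add: mdeg_def)
    ultimately show "u \<in> mono_subst (block_exponent q) ` {m. Poly_Mapping.keys m \<subseteq> xvars q c n \<and> mdeg m = Suc d}"
      by blast
  qed
qed

lemma keys_block_monomial:
  assumes "Poly_Mapping.keys m \<subseteq> xvars q c n"
  shows "Poly_Mapping.keys (mono_subst (block_exponent q) m) \<subseteq> yvars q c n"
proof -
  have "mono_subst (block_exponent q) m \<in>
      of_blocks q ` (\<Pi>\<^sub>E j\<in>{1..q}. multisets_of_size ({1..c j} \<times> {1..n j}) (mdeg m))"
    unfolding image_monomials_eq_blocks[symmetric] using assms by blast
  then show ?thesis
    by (fastforce simp: in_keys_iff lookup_of_blocks yvars_def multisets_of_size_def PiE_iff split: if_splits)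
qed

text \<open>
  The toric ring is the Segre product of \<open>q\<close> polynomial rings in \<open>c j * n j\<close> variables, whence the
  product of their Hilbert functions.
\<close>

lemma hilbert_fun_toric_ideal:
  "hilbert_fun (xvars q c n) (toric_ideal q c n :: (xvar, 'k::field) mpoly set) d =
     (\<Prod>j=1..q. (c j * n j + d - 1) choose d)"
proof -
  let ?B = "\<Pi>\<^sub>E j\<in>{1..q}. multisets_of_size ({1..c j} \<times> {1..n j}) d"
  have "hilbert_fun (xvars q c n) (toric_ideal q c n :: (xvar, 'k) mpoly set) d =
      card (mono_subst (block_exponent q) ` {m. Poly_Mapping.keys m \<subseteq> xvars q c n \<and> mdeg m = d})"
    unfolding toric_ideal_def Phi_eq_pushforward
    by (rule hilbert_fun_kernel_pushforward)
       (auto simp: mono_subst_add image_monomials_eq_blocks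
             intro!: finite_imageI finite_PiE dest!: keys_block_monomial[THEN subsetD])
  also have "\<dots> = card ?B"
    unfolding image_monomials_eq_blocks by (rule card_image[OF inj_of_blocks])
  also have "\<dots> = (\<Prod>j=1..q. (c j * n j + d - 1) choose d)"
    by (simp add: card_PiE card_multisets_of_size)
  finally show ?thesis .
qed

section \<open>Power series with multiplicatively separated coefficients\<close>

lemma mps_nth_simps [simp]:
  "mps_nth (f + g) e = mps_nth f e + mps_nth g e"
  "mps_nth (f - g) e = mps_nth f e - mps_nth g e"
  "mps_nth (0 :: ('v, 'a::comm_ring_1) mps) e = 0"
  for f g :: "('v, 'a::comm_ring_1) mps"
  by (simp_all add: plus_mps_def minus_mps_def zero_mps_def)

lemma mps_var_mult:
  "mps_nth (mps_var v * f) e =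
     (if Poly_Mapping.lookup e v = 0 then 0 else mps_nth f (e - Poly_Mapping.single v 1))"
proof -
  let ?s = "Poly_Mapping.single v (1::nat)"
  have split: "?s + b = e \<longleftrightarrow> Poly_Mapping.lookup e v \<noteq> 0 \<and> b = e - ?s" for b
  proof
    assume "Poly_Mapping.lookup e v \<noteq> 0 \<and> b = e - ?s"
    then show "?s + b = e"
      by (intro poly_mapping_eqI) (auto simp: lookup_add lookup_minus lookup_single when_def)
  qed (auto simp: lookup_add)
  have "mps_nth (mps_var v * f) e =
      (\<Sum>p\<in>{(a, b). a + b = e}. if p = (?s, e - ?s) then mps_nth f (e - ?s) else 0)"
    unfolding times_mps_def mps_nth_Abs
  proof (rule sum.cong)
    fix p assume p: "p \<in> {(a, b). a + b = e}"
    show "(case p of (a, b) \<Rightarrow> mps_nth (mps_var v) a * mps_nth f b) =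
        (if p = (?s, e - ?s) then mps_nth f (e - ?s) else 0)"
      using p split[of "snd p"] by (cases "fst p = ?s") (auto simp: mps_var_def)
  qed simp
  also have "\<dots> = (if ?s + (e - ?s) = e then mps_nth f (e - ?s) else 0)"
    by (simp add: finite_splits)
  finally show ?thesis unfolding split by auto
qed

text \<open>
  Quotients of power series are computed by guessing the answer and multiplying back.
\<close>

lemma mps_divide_eq:
  fixes f g h :: "('v, 'a::field) mps"
  assumes "mps_nth g 0 \<noteq> 0" "h * g = f"
  shows "f / g = h"
proof -
  have "f / g = h * (g * inverse g)" by (simp only: divide_mps_def assms(2)[symmetric] mult.assoc)
  then show ?thesis by (simp add: mps_inverse[OF assms(1)])
qed

text \<open>
  Series in \<open>s\<^sub>1, \<dots>, s\<^sub>q, t\<close> whose coefficient at \<open>s\<^sub>1\<^bsup>N\<^sub>1\<^esup> \<cdots> s\<^sub>q\<^bsup>N\<^sub>q\<^esup> t\<^bsup>d\<^esup>\<close> is a product of factors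
  \<open>F j d N\<^sub>j\<close>. Such a family is closed under multiplication by a polynomial in a single \<open>s\<^sub>j\<close>, which
  changes only the \<open>j\<close>-th factor, so that identities between products over all \<open>j\<close> reduce to
  identities between sequences in one index.
\<close>

definition separated_series :: "nat \<Rightarrow> (nat \<Rightarrow> nat \<Rightarrow> nat \<Rightarrow> complex) \<Rightarrow> (st_var, complex) mps" where
  "separated_series q F = Abs_mps (\<lambda>e. if \<forall>j. j \<notin> {1..q} \<longrightarrow> Poly_Mapping.lookup e (S j) = 0
     then \<Prod>j=1..q. F j (Poly_Mapping.lookup e T) (Poly_Mapping.lookup e (S j)) else 0)"

lemma separated_series_cong:
  "(\<And>j d N. j \<in> {1..q} \<Longrightarrow> F j d N = G j d N) \<Longrightarrow> separated_series q F = separated_series q G"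
  unfolding separated_series_def by (rule arg_cong[where f = Abs_mps]) (auto simp: fun_eq_iff intro!: prod.cong)

lemma separated_series_mult_var:
  assumes j: "j \<in> {1..q}"
  shows "mps_const a * mps_var (S j) * separated_series q F =
    separated_series q (F(j := \<lambda>d N. if N = 0 then 0 else a * F j d (N - 1)))"
proof (rule mps_eqI)
  fix e :: "st_var monomial"
  let ?G = "F(j := \<lambda>d N. if N = 0 then 0 else a * F j d (N - 1))"
  let ?e = "e - Poly_Mapping.single (S j) 1"
  let ?l = "Poly_Mapping.lookup"
  have lk: "?l ?e T = ?l e T" "?l ?e (S i) = (if i = j then ?l e (S i) - 1 else ?l e (S i))" for i
    by (auto simp: lookup_minus lookup_single when_def)
  have P: "(\<Prod>i\<in>{1..q}. h i) = h j * (\<Prod>i\<in>{1..q} - {j}. h i)" for h :: "nat \<Rightarrow> complex"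
    using j by (intro prod.remove) auto
  have supp: "(\<forall>i. i \<notin> {1..q} \<longrightarrow> ?l ?e (S i) = 0) \<longleftrightarrow> (\<forall>i. i \<notin> {1..q} \<longrightarrow> ?l e (S i) = 0)"
    using j unfolding lk by auto
  have "mps_nth (mps_const a * mps_var (S j) * separated_series q F) e =
      a * (if ?l e (S j) = 0 then 0 else mps_nth (separated_series q F) ?e)"
    by (simp only: mult.assoc mps_const_mult mps_var_mult)
  also have "\<dots> = mps_nth (separated_series q ?G) e"
    unfolding separated_series_def mps_nth_Abs supp unfolding P lk by auto
  finally show "mps_nth (mps_const a * mps_var (S j) * separated_series q F) e = mps_nth (separated_series q ?G) e" .
qed

lemma separated_series_diff_var:
  assumes j: "j \<in> {1..q}"
  shows "(1 - mps_const a * mps_var (S j)) * separated_series q F =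
    separated_series q (F(j := \<lambda>d N. F j d N - (if N = 0 then 0 else a * F j d (N - 1))))"
proof -
  have P: "(\<Prod>i\<in>{1..q}. h i) = h j * (\<Prod>i\<in>{1..q} - {j}. h i)" for h :: "nat \<Rightarrow> complex"
    using j by (intro prod.remove) auto
  show ?thesis
    unfolding left_diff_distrib mult_1_left separated_series_mult_var[OF j]
    by (rule mps_eqI, unfold mps_nth_simps separated_series_def mps_nth_Abs P) (auto simp: left_diff_distrib)
qed

lemma separated_series_prod_mult_var:
  assumes "J \<subseteq> {1..q}"
  shows "(\<Prod>j\<in>J. mps_const (a j) * mps_var (S j)) * separated_series q F =
    separated_series q (\<lambda>j. if j \<in> J then \<lambda>d N. if N = 0 then 0 else a j * F j d (N - 1) else F j)"
  using finite_subset[OF assms finite_atLeastAtMost] assms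
proof (induction J rule: finite_induct)
  case (insert j J)
  let ?f = "\<lambda>j. mps_const (a j) * mps_var (S j)"
  let ?D = "\<lambda>j d N. if N = 0 then 0 else a j * F j d (N - 1)"
  have "(\<Prod>j\<in>insert j J. ?f j) * separated_series q F = ?f j * ((\<Prod>j\<in>J. ?f j) * separated_series q F)"
    using insert.hyps by (simp add: mult.assoc)
  also have "\<dots> = separated_series q (\<lambda>i. if i \<in> insert j J then ?D i else F i)"
    using insert.prems insert.hyps
    by (subst insert.IH) (auto simp: separated_series_mult_var intro!: separated_series_cong)
  finally show ?case .
qed simp

lemma separated_series_prod_diff_var:
  assumes "J \<subseteq> {1..q}"
  shows "(\<Prod>j\<in>J. 1 - mps_const (a j) * mps_var (S j)) * separated_series q F =
    separated_series q (\<lambda>j. if j \<in> J then \<lambda>d N. F j d N - (if N = 0 then 0 else a j * F j d (N - 1)) else F j)"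
  using finite_subset[OF assms finite_atLeastAtMost] assms
proof (induction J rule: finite_induct)
  case (insert j J)
  let ?f = "\<lambda>j. 1 - mps_const (a j) * mps_var (S j)"
  let ?D = "\<lambda>j d N. F j d N - (if N = 0 then 0 else a j * F j d (N - 1))"
  have "(\<Prod>j\<in>insert j J. ?f j) * separated_series q F = ?f j * ((\<Prod>j\<in>J. ?f j) * separated_series q F)"
    using insert.hyps by (simp add: mult.assoc)
  also have "\<dots> = separated_series q (\<lambda>i. if i \<in> insert j J then ?D i else F i)"
    using insert.prems insert.hyps
    by (subst insert.IH) (auto simp: separated_series_diff_var intro!: separated_series_cong)
  finally show ?case .
qed simp

text \<open>
  The condition \<open>d = 0\<close> can only be imposed through one of the factors; for \<open>q = 0\<close> the
  left-hand side would be the geometric series in \<open>t\<close>.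
\<close>

lemma separated_series_one:
  assumes "q \<ge> 1"
  shows "separated_series q (\<lambda>j d N. if d = 0 \<and> N = 0 then 1 else 0) = 1"
proof (rule mps_eqI)
  fix e :: "st_var monomial"
  let ?l = "Poly_Mapping.lookup e"
  let ?F = "\<lambda>(j::nat) d N. if d = 0 \<and> N = 0 then 1 else (0 :: complex)"
  show "mps_nth (separated_series q ?F) e = mps_nth 1 e"
  proof (cases "e = 0")
    case False
    have "(\<Prod>j=1..q. ?F j (?l T) (?l (S j))) = 0" if "\<forall>j. j \<notin> {1..q} \<longrightarrow> ?l (S j) = 0"
    proof -
      from False obtain v where v: "?l v \<noteq> 0" by (metis lookup_zero poly_mapping_eqI)
      have "\<exists>j\<in>{1..q}. \<not> (?l T = 0 \<and> ?l (S j) = 0)"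
      proof (cases v)
        case T
        then show ?thesis using v assms by (intro bexI[of _ 1]) auto
      next
        case (S j)
        then show ?thesis using v that by (intro bexI[of _ j]) auto
      qed
      then show ?thesis by (intro prod_zero) auto
    qed
    then show ?thesis using False by (auto simp: separated_series_def one_mps_def)
  qed (simp add: separated_series_def one_mps_def)
qed

lemma var_T_mult_separated_series:
  assumes "q \<ge> 1"
  shows "mps_var T * separated_series q F = separated_series q (\<lambda>j d N. if d = 0 then 0 else F j (d - 1) N)"
  using assms
  by (intro mps_eqI) (auto simp: mps_var_mult separated_series_def lookup_minus lookup_single when_def intro!: prod_zero)

lemma separated_series_split_degree:
  assumes "q \<ge> 1"
  shows "separated_series q (\<lambda>j d N. if d = 0 then f j N else g j d N) =
    separated_series q (\<lambda>j d N. if d = 0 then f j N else 0) + separated_series q (\<lambda>j d N. if d = 0 then 0 else g j d N)"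
proof (rule mps_eqI)
  fix e :: "st_var monomial"
  show "mps_nth (separated_series q (\<lambda>j d N. if d = 0 then f j N else g j d N)) e =
      mps_nth (separated_series q (\<lambda>j d N. if d = 0 then f j N else 0) +
        separated_series q (\<lambda>j d N. if d = 0 then 0 else g j d N)) e"
    using assms by (cases "Poly_Mapping.lookup e T = 0") (auto simp: separated_series_def power_0_left)
qed

text \<open>
  Expanding in powers of \<open>t\<close>, the quotient is the sum over \<open>d\<close> of \<open>t ^ d\<close> times the product of the
  \<open>a\<^sub>j s\<^sub>j / (1 - a\<^sub>j s\<^sub>j) ^ (d + 1)\<close>, and each factor is a shifted negative binomial series. Multiplying
  back by the denominator is Pascal's rule: multiplication by \<open>1 - a\<^sub>j s\<^sub>j\<close> lowers \<open>d\<close> by one in the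
  \<open>j\<close>-th factor, and doing so for all \<open>j\<close> amounts to multiplication by \<open>t\<close>, except that the
  terms with \<open>d = 0\<close> leave the numerator behind.
\<close>

lemma rational_summand:
  fixes a :: "nat \<Rightarrow> complex"
  assumes q: "q \<ge> 1"
  shows "(\<Prod>j=1..q. mps_const (a j) * mps_var (S j)) /
      ((\<Prod>j=1..q. 1 - mps_const (a j) * mps_var (S j)) - mps_var T) =
    separated_series q (\<lambda>j d N. if N = 0 then 0 else of_nat ((N - 1 + d) choose d) * a j ^ N)"
    (is "?n / (?p - _) = separated_series q ?F")
proof (rule mps_divide_eq)
  have var0: "mps_nth (mps_var v :: (st_var, complex) mps) 0 = 0" for v
  proof -
    have "0 \<noteq> Poly_Mapping.single v (1::nat)" by (metis lookup_single_eq lookup_zero zero_neq_one)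
    then show ?thesis by (simp add: mps_var_def)
  qed
  have unit: "mps_nth (f * g) 0 = mps_nth f 0 * mps_nth g 0" for f g :: "(st_var, complex) mps"
  proof -
    have "{(x, y). x + y = (0 :: st_var monomial)} = {(0, 0)}"
      by (auto simp: mdeg_eq_0_iff) (metis mdeg_add mdeg_eq_0_iff add_is_0)+
    then show ?thesis by (simp add: times_mps_def)
  qed
  have "mps_nth (\<Prod>j\<in>J. 1 - mps_const (a j) * mps_var (S j)) 0 = 1" if "finite J" for J
    using that by (induction J rule: finite_induct)
      (auto simp: unit mps_const_mult var0 one_mps_def)
  then show "mps_nth (?p - mps_var T) 0 \<noteq> 0" by (simp add: var0)
  have pascal: "?F j (Suc d) N - (if N = 0 then 0 else a j * ?F j (Suc d) (N - 1)) = ?F j d N" for j d N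
  proof (cases N)
    case (Suc M)
    then show ?thesis by (cases M) (auto simp: algebra_simps)
  qed simp
  have start: "?F j 0 N - (if N = 0 then 0 else a j * ?F j 0 (N - 1)) = (if N = 1 then a j else 0)" for j N
  proof (cases N)
    case (Suc M)
    then show ?thesis by (cases M) auto
  qed simp
  have n: "?n = separated_series q (\<lambda>j d N. if d = 0 \<and> N = 1 then a j else 0)"
    using separated_series_prod_mult_var[of "{1..q}" q a "\<lambda>j d N. if d = 0 \<and> N = 0 then 1 else 0"]
    unfolding separated_series_one[OF q] mult_1_right by (auto intro!: separated_series_cong)
  have "?p * separated_series q ?F = separated_series q (\<lambda>j d N. if d = 0 then (if N = 1 then a j else 0) else ?F j (d - 1) N)"
    unfolding separated_series_prod_diff_var[OF order_refl]
  proof (rule separated_series_cong)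
    fix j d N assume j: "j \<in> {1..q}"
    show "(if j \<in> {1..q} then \<lambda>d N. ?F j d N - (if N = 0 then 0 else a j * ?F j d (N - 1)) else ?F j) d N =
        (if d = 0 then (if N = 1 then a j else 0) else ?F j (d - 1) N)"
    proof (cases d)
      case 0
      show ?thesis unfolding 0 if_P[OF j] if_P[OF refl] by (rule start)
    next
      case (Suc d')
      show ?thesis unfolding Suc if_P[OF j] if_not_P[OF nat.distinct(2)] diff_Suc_1 by (rule pascal)
    qed
  qed
  also have "\<dots> = ?n + mps_var T * separated_series q ?F"
    unfolding n var_T_mult_separated_series[OF q]
    by (subst separated_series_split_degree[OF q], intro arg_cong2[where f = "(+)"] separated_series_cong) auto
  finally show "separated_series q ?F * (?p - mps_var T) = ?n"
    by (simp add: algebra_simps)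
qed

section \<open>Averaging over roots of unity\<close>

lemma sum_powers_root_of_unity:
  assumes "primitive_root_of_unity c w" "c \<ge> 1"
  shows "(\<Sum>m=1..c. (w ^ m) ^ N) = (if c dvd N then of_nat c else 0)"
proof -
  have wc: "w ^ c = 1" and prim: "\<And>k. k \<in> {1..<c} \<Longrightarrow> w ^ k \<noteq> 1"
    using assms by (auto simp: primitive_root_of_unity_def)
  have "w ^ N = (w ^ c) ^ (N div c) * w ^ (N mod c)"
    by (simp flip: power_mult power_add)
  then have wN: "w ^ N = w ^ (N mod c)" by (simp add: wc)
  have swap: "(w ^ m) ^ N = (w ^ N) ^ m" for m by (simp flip: power_mult add: mult.commute)
  show ?thesis
  proof (cases "c dvd N")
    case True
    then show ?thesis using wN by (simp add: swap)
  next
    case False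
    then have "N mod c \<in> {1..<c}" using assms(2) by (auto simp: dvd_eq_mod_eq_0)
    then have ne: "w ^ N \<noteq> 1" using wN prim by metis
    have "(\<Sum>m=1..c. (w ^ N) ^ m) = w ^ N * (\<Sum>m<c. (w ^ N) ^ m)"
      using sum.atLeast1_atMost_eq[of "\<lambda>m. (w ^ N) ^ m" c] by (simp add: sum_distrib_left)
    also have "(\<Sum>m<c. (w ^ N) ^ m) = 0"
      using ne swap[of c] by (simp add: geometric_sum wc)
    finally show ?thesis using False by (simp add: swap)
  qed
qed

text \<open>
  Averaging over the powers of a primitive \<open>c\<^sub>j\<close>-th root of unity in each variable keeps exactly
  the terms whose exponents are divisible by the \<open>c\<^sub>j\<close>.
\<close>

lemma average_over_roots:
  assumes q: "q \<ge> 1" and c: "\<forall>j\<in>{1..q}. c j \<ge> 1"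
    and w: "\<forall>j\<in>{1..q}. primitive_root_of_unity (c j) (\<omega> j)"
  shows "mps_const (1 / (\<Prod>j=1..q. of_nat (c j))) *
    (\<Sum>m\<in>(\<Pi>\<^sub>E j\<in>{1..q}. {1..c j}).
       (\<Prod>j=1..q. mps_const (\<omega> j ^ m j) * mps_var (S j)) /
       ((\<Prod>j=1..q. 1 - mps_const (\<omega> j ^ m j) * mps_var (S j)) - mps_var T)) =
    separated_series q (\<lambda>j d N. if N \<noteq> 0 \<and> c j dvd N then of_nat ((N - 1 + d) choose d) else 0)"
    (is "_ = separated_series q ?G")
proof (rule mps_eqI, unfold rational_summand[OF q] mps_const_mult mps_nth_sum)
  fix e :: "st_var monomial"
  let ?d = "Poly_Mapping.lookup e T" and ?N = "\<lambda>j. Poly_Mapping.lookup e (S j)"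
  let ?F = "\<lambda>j i. if ?N j = 0 then 0 else of_nat ((?N j - 1 + ?d) choose ?d) * (\<omega> j ^ i) ^ ?N j"
  have filter: "(\<Sum>i=1..c j. ?F j i) = of_nat (c j) * ?G j ?d (?N j)" if "j \<in> {1..q}" for j
    using sum_powers_root_of_unity[of "c j" "\<omega> j" "?N j"] w c that
    by (cases "?N j = 0") (auto simp flip: sum_distrib_left)
  have "(\<Sum>m\<in>(\<Pi>\<^sub>E j\<in>{1..q}. {1..c j}). \<Prod>j=1..q. ?F j (m j)) = (\<Prod>j=1..q. \<Sum>i=1..c j. ?F j i)"
    by (rule prod_sum_PiE[symmetric]) auto
  also have "\<dots> = (\<Prod>j=1..q. of_nat (c j) * ?G j ?d (?N j))"
    by (rule prod.cong[OF refl filter])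
  finally have sum: "1 / (\<Prod>j=1..q. of_nat (c j)) *
      (\<Sum>m\<in>(\<Pi>\<^sub>E j\<in>{1..q}. {1..c j}). \<Prod>j=1..q. ?F j (m j)) = (\<Prod>j=1..q. ?G j ?d (?N j))"
    using c by (auto simp: prod.distrib)
  show "1 / (\<Prod>j=1..q. of_nat (c j)) * (\<Sum>m\<in>(\<Pi>\<^sub>E j\<in>{1..q}. {1..c j}).
      mps_nth (separated_series q (\<lambda>j d N. if N = 0 then 0
        else of_nat ((N - 1 + d) choose d) * (\<omega> j ^ m j) ^ N)) e) = mps_nth (separated_series q ?G) e"
  proof (cases "\<forall>j. j \<notin> {1..q} \<longrightarrow> ?N j = 0")
    case True
    show ?thesis unfolding separated_series_def mps_nth_Abs if_P[OF True] by (rule sum)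
  next
    case False
    then show ?thesis unfolding separated_series_def mps_nth_Abs if_not_P[OF False] by simp
  qed
qed

section \<open>The equivariant Hilbert series\<close>

text \<open>
  The substitution of \<open>r\<^sub>j\<^bsup>c\<^sub>j\<^esup>\<close> for \<open>s\<^sub>j\<close> makes \<open>N\<^sub>j = c\<^sub>j n\<^sub>j\<close> the exponent of \<open>r\<^sub>j\<close>. The Hilbert function depends
  on \<open>n\<^sub>j\<close> only through this product, hence it becomes a function of the exponents alone.
\<close>

lemma root_embed_equivH:
  assumes c: "\<forall>j\<in>{1..q}. c j \<ge> 1"
  shows "root_embed c (equivH q c (toric_ideal q c :: (nat \<Rightarrow> nat) \<Rightarrow> (xvar, 'k::field) mpoly set)) =
    separated_series q (\<lambda>j d N. if N \<noteq> 0 \<and> c j dvd N then of_nat ((N - 1 + d) choose d) else 0)"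
    (is "root_embed c (equivH q c ?I) = separated_series q ?G")
proof (rule mps_eqI)
  fix e :: "st_var monomial"
  let ?d = "Poly_Mapping.lookup e T" and ?N = "\<lambda>j. Poly_Mapping.lookup e (S j)"
  let ?e = "Poly_Mapping.mapp (\<lambda>v a. a div root_index c v) e"
  have lk: "Poly_Mapping.lookup ?e v = Poly_Mapping.lookup e v div root_index c v" for v
    by (auto simp: lookup_mapp when_def in_keys_iff)
  have all: "(\<forall>v. P v) \<longleftrightarrow> P T \<and> (\<forall>j. P (S j))" for P
    by (metis st_var.exhaust)
  have lhs: "mps_nth (root_embed c (equivH q c ?I)) e =
      (if (\<forall>j. c j dvd ?N j) \<and> (\<forall>j. j \<in> {1..q} \<longleftrightarrow> ?N j div c j \<ge> 1)
       then \<Prod>j=1..q. of_nat ((c j * (?N j div c j) + ?d - 1) choose ?d) else 0)"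
    unfolding root_embed_def equivH_def mps_nth_Abs lk Let_def hilbert_fun_toric_ideal all[of "\<lambda>v. _ v dvd _ v"]
    by simp
  show "mps_nth (root_embed c (equivH q c ?I)) e = mps_nth (separated_series q ?G) e"
  proof (cases "(\<forall>j\<in>{1..q}. ?N j \<noteq> 0 \<and> c j dvd ?N j) \<and> (\<forall>j. j \<notin> {1..q} \<longrightarrow> ?N j = 0)")
    case True
    then have support: "j \<in> {1..q} \<longleftrightarrow> ?N j div c j \<ge> 1" for j
      using c by (cases "j \<in> {1..q}") (auto simp: Suc_le_eq div_greater_zero_iff dvd_imp_le)
    have dvd: "c j dvd ?N j" for j
      using True by (cases "j \<in> {1..q}") auto
    have top: "c j * (?N j div c j) + ?d - 1 = ?N j - 1 + ?d" if "j \<in> {1..q}" for j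
    proof -
      have "?N j \<noteq> 0" "c j * (?N j div c j) = ?N j" using True that by auto
      then show ?thesis by simp
    qed
    have prods: "(\<Prod>j=1..q. of_nat ((c j * (?N j div c j) + ?d - 1) choose ?d)) = (\<Prod>j=1..q. ?G j ?d (?N j))"
    proof (rule prod.cong[OF refl])
      fix j assume j: "j \<in> {1..q}"
      then have "?N j \<noteq> 0 \<and> c j dvd ?N j" using True by blast
      then show "of_nat ((c j * (?N j div c j) + ?d - 1) choose ?d) = ?G j ?d (?N j)"
        unfolding top[OF j] by (rule if_P[symmetric])
    qed
    have cond: "(\<forall>j. c j dvd ?N j) \<and> (\<forall>j. j \<in> {1..q} \<longleftrightarrow> ?N j div c j \<ge> 1)"
      using support dvd by blast
    show ?thesis
      unfolding lhs separated_series_def mps_nth_Abs if_P[OF cond] if_P[OF conjunct2[OF True]] by (rule prods)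
  next
    case False
    then show ?thesis
    proof (cases "\<forall>j. j \<notin> {1..q} \<longrightarrow> ?N j = 0")
      case True
      with False obtain j where j: "j \<in> {1..q}" "?N j = 0 \<or> \<not> c j dvd ?N j" by auto
      then have "?G j ?d (?N j) = 0" by auto
      then have "(\<Prod>j=1..q. ?G j ?d (?N j)) = 0"
        unfolding prod_zero_iff[OF finite_atLeastAtMost] using j(1) by blast
      moreover have "\<not> ((\<forall>j. c j dvd ?N j) \<and> (\<forall>j. j \<in> {1..q} \<longleftrightarrow> ?N j div c j \<ge> 1))"
        using j by (metis div_0 not_one_le_zero)
      ultimately show ?thesis unfolding lhs separated_series_def mps_nth_Abs by (simp only: if_False if_cancel)
    next
      case False
      then obtain j where j: "j \<notin> {1..q}" "?N j \<noteq> 0" by auto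
      \<comment> \<open>For \<open>j\<close> outside \<open>{1..q}\<close> the number \<open>c j\<close> is arbitrary; if it is \<open>0\<close>, it does not divide
        the nonzero exponent.\<close>
      have "?N j div c j \<ge> 1" if "c j dvd ?N j"
        using that j(2) by (auto elim!: dvdE simp: Suc_le_eq)
      then have "\<not> ((\<forall>j. c j dvd ?N j) \<and> (\<forall>j. j \<in> {1..q} \<longleftrightarrow> ?N j div c j \<ge> 1))"
        using j(1) by blast
      then show ?thesis unfolding lhs separated_series_def mps_nth_Abs using False by (simp only: if_False)
    qed
  qed
qed

theorem proposition5p4:
  fixes q :: nat and c :: "nat \<Rightarrow> nat" and \<omega> :: "nat \<Rightarrow> complex"
  assumes "q \<ge> 1"
    and "\<forall>j\<in>{1..q}. c j \<ge> 1"
    and "\<forall>j\<in>{1..q}. primitive_root_of_unity (c j) (\<omega> j)"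
  shows "root_embed c
      (equivH q c (toric_ideal q c :: (nat \<Rightarrow> nat) \<Rightarrow> (xvar, 'k::field) mpoly set)) =
    mps_const (1 / (\<Prod>j=1..q. of_nat (c j))) *
    (\<Sum>m\<in>(\<Pi>\<^sub>E j\<in>{1..q}. {1..c j}).
       (\<Prod>j=1..q. mps_const (\<omega> j ^ m j) * mps_var (S j)) /
       ((\<Prod>j=1..q. 1 - mps_const (\<omega> j ^ m j) * mps_var (S j)) - mps_var T))"
  using root_embed_equivH[OF assms(2)] average_over_roots[OF assms] by simp

end
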